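(* Let $p$ be a prime with $p\neq 2,3$, and let $G=\langle a,b,c\mid a^{4}=b^{p}=c^{p}=[a,b]=[b,c]=1,\ a^{-1}ca=c^{-1}\rangle$. Then $\mathrm{Aut}(G)\simeq\mathbb{Z}_{p}\rtimes((\mathbb{Z}_{p-1}\times\mathbb{Z}_{p-1})\times\mathbb{Z}_{2})$.
   Context: $\mathbb{Z}_n$ is the cyclic group of order $n$; $[x,y]=x^{-1}y^{-1}xy$. (This is a group of order $p^2q^2$ with $q=2$, $p\neq q$ and $pq\neq 6$.) $X\rtimes Y$ denotes a semidirect product with normal subgroup $X$ with respect to some homomorphism $Y\to\mathrm{Aut}(X)$; the statement asserts that $\mathrm{Aut}(G)$ is isomorphic to such a semidirect product for some choice of action. *)

theory Defs
  imports "HOL-Algebra.Bij" "HOL-Algebra.Elementary_Groups" "HOL-Computational_Algebra.Primes"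
begin

section \<open>Groups given by generators and relations\<close>

text \<open>
  A word over the type \<open>'g\<close> of generators is a list of letters; \<open>(x, True)\<close> stands
  for \<open>x\<close> and \<open>(x, False)\<close> for its formal inverse.
\<close>

type_synonym 'g word = "('g \<times> bool) list"

definition gen :: "'g \<Rightarrow> 'g word" where
  "gen x = [(x, True)]"

definition winv :: "'g word \<Rightarrow> 'g word" where
  "winv w = rev (map (\<lambda>(x, e). (x, \<not> e)) w)"

definition wpow :: "'g word \<Rightarrow> nat \<Rightarrow> 'g word" where
  "wpow w n = concat (replicate n w)"

definition wcommutator :: "'g word \<Rightarrow> 'g word \<Rightarrow> 'g word" where
  "wcommutator x y = winv x @ winv y @ x @ y"

text \<open>
  A pair \<open>(l, r)\<close> in \<open>R\<close> is the defining relation \<open>l = r\<close>.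
\<close>

inductive word_eq :: "('g word \<times> 'g word) set \<Rightarrow> 'g word \<Rightarrow> 'g word \<Rightarrow> bool"
  for R where
  refl: "word_eq R w w"
| sym: "word_eq R v w \<Longrightarrow> word_eq R w v"
| trans: "word_eq R u v \<Longrightarrow> word_eq R v w \<Longrightarrow> word_eq R u w"
| cancel: "word_eq R (u @ [(x, e), (x, \<not> e)] @ v) (u @ v)"
| relation: "(l, r) \<in> R \<Longrightarrow> word_eq R (u @ l @ v) (u @ r @ v)"

definition word_class :: "('g word \<times> 'g word) set \<Rightarrow> 'g word \<Rightarrow> 'g word set" where
  "word_class R w = {v. word_eq R w v}"

definition presented_group :: "('g word \<times> 'g word) set \<Rightarrow> 'g word set monoid" where
  "presented_group R =
    \<lparr>carrier = range (word_class R),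
     monoid.mult = (\<lambda>A B. \<Union>u\<in>A. \<Union>v\<in>B. word_class R (u @ v)),
     one = word_class R []\<rparr>"

lemma word_eq_append_context:
  "word_eq R v w \<Longrightarrow> word_eq R (s @ v @ t) (s @ w @ t)"
proof (induction rule: word_eq.induct)
  case (cancel u x e v)
  show ?case using word_eq.cancel[of R "s @ u" x e "v @ t"] by simp
next
  case (relation l r u v)
  then show ?case using word_eq.relation[of l r R "s @ u" "v @ t"] by simp
next
  case (refl w)
  show ?case by (rule word_eq.refl)
next
  case (sym v w)
  then show ?case using word_eq.sym by blast
next
  case (trans u v w)
  then show ?case by (blast intro: word_eq.trans)
qed

lemma word_eq_append:
  assumes "word_eq R u u'" "word_eq R v v'"
  shows "word_eq R (u @ v) (u' @ v')"
proof (rule word_eq.trans)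
  show "word_eq R (u @ v) (u' @ v)"
    using word_eq_append_context[OF assms(1), of "[]" v] by simp
  show "word_eq R (u' @ v) (u' @ v')"
    using word_eq_append_context[OF assms(2), of u' "[]"] by simp
qed

lemma word_class_eq_iff: "word_class R v = word_class R w \<longleftrightarrow> word_eq R v w"
proof
  assume "word_class R v = word_class R w"
  then show "word_eq R v w"
    using word_eq.refl[of R w] unfolding word_class_def by blast
next
  assume vw: "word_eq R v w"
  show "word_class R v = word_class R w"
    using word_eq.trans[OF vw] word_eq.trans[OF word_eq.sym[OF vw]]
    unfolding word_class_def by blast
qed

lemma presented_group_mult:
  "word_class R u \<otimes>\<^bsub>presented_group R\<^esub> word_class R v = word_class R (u @ v)"
proof -
  have "word_class R (u' @ v') = word_class R (u @ v)"
    if "u' \<in> word_class R u" "v' \<in> word_class R v" for u' v'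
    unfolding word_class_eq_iff
    using that by (intro word_eq.sym[OF word_eq_append]) (simp_all add: word_class_def)
  moreover have "u \<in> word_class R u" "v \<in> word_class R v"
    by (simp_all add: word_class_def word_eq.refl)
  ultimately have "(\<Union>u'\<in>word_class R u. \<Union>v'\<in>word_class R v. word_class R (u' @ v'))
      = word_class R (u @ v)"
    by blast
  then show ?thesis by (simp add: presented_group_def)
qed

lemma word_eq_winv_left: "word_eq R (winv w @ w) []"
proof (induction w)
  case Nil
  show ?case by (simp add: winv_def word_eq.refl)
next
  case (Cons a w)
  obtain x e where a: "a = (x, e)" by force
  have "word_eq R (winv (a # w) @ a # w) (winv w @ w)"
    using word_eq.cancel[of R "winv w" x "\<not> e" w] by (simp add: winv_def a)
  then show ?case using Cons word_eq.trans by blast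
qed

lemma group_presented_group: "group (presented_group R)"
proof (rule groupI)
  fix A assume "A \<in> carrier (presented_group R)"
  then obtain w where w: "A = word_class R w" by (auto simp: presented_group_def)
  have "word_class R (winv w) \<otimes>\<^bsub>presented_group R\<^esub> A = \<one>\<^bsub>presented_group R\<^esub>"
    unfolding w presented_group_mult
    by (simp add: presented_group_def word_class_eq_iff word_eq_winv_left)
  then show "\<exists>B\<in>carrier (presented_group R). B \<otimes>\<^bsub>presented_group R\<^esub> A = \<one>\<^bsub>presented_group R\<^esub>"
    by (auto simp: presented_group_def)
next
  fix A B assume "A \<in> carrier (presented_group R)" "B \<in> carrier (presented_group R)"
  then show "A \<otimes>\<^bsub>presented_group R\<^esub> B \<in> carrier (presented_group R)"
    using presented_group_mult[of R] by (auto simp: presented_group_def)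
next
  fix A B C assume "A \<in> carrier (presented_group R)" "B \<in> carrier (presented_group R)"
    "C \<in> carrier (presented_group R)"
  then obtain u v w where "A = word_class R u" "B = word_class R v" "C = word_class R w"
    by (auto simp: presented_group_def)
  then show "A \<otimes>\<^bsub>presented_group R\<^esub> B \<otimes>\<^bsub>presented_group R\<^esub> C
    = A \<otimes>\<^bsub>presented_group R\<^esub> (B \<otimes>\<^bsub>presented_group R\<^esub> C)"
    by (simp add: presented_group_mult)
next
  show "\<one>\<^bsub>presented_group R\<^esub> \<in> carrier (presented_group R)"
    by (simp add: presented_group_def)
next
  fix A assume "A \<in> carrier (presented_group R)"
  then obtain w where "A = word_class R w" by (auto simp: presented_group_def)
  moreover have "\<one>\<^bsub>presented_group R\<^esub> = word_class R []"
    by (simp add: presented_group_def)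
  ultimately show "\<one>\<^bsub>presented_group R\<^esub> \<otimes>\<^bsub>presented_group R\<^esub> A = A"
    by (simp only: presented_group_mult append_Nil)
qed


section \<open>Semidirect products\<close>

definition semidirect_product ::
  "('a, 'c) monoid_scheme \<Rightarrow> ('b, 'd) monoid_scheme \<Rightarrow> ('b \<Rightarrow> 'a \<Rightarrow> 'a) \<Rightarrow> ('a \<times> 'b) monoid" where
  "semidirect_product N H \<phi> =
    \<lparr>carrier = carrier N \<times> carrier H,
     monoid.mult = (\<lambda>(x, y) (x', y'). (x \<otimes>\<^bsub>N\<^esub> \<phi> y x', y \<otimes>\<^bsub>H\<^esub> y')),
     one = (\<one>\<^bsub>N\<^esub>, \<one>\<^bsub>H\<^esub>)\<rparr>"

lemma group_semidirect_product:
  assumes N: "group N" and H: "group H" and \<phi>: "\<phi> \<in> hom H (AutoGroup N)"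
  shows "group (semidirect_product N H \<phi>)"
proof -
  interpret N: group N by fact
  interpret H: group H by fact
  interpret A: group "AutoGroup N" by (rule N.AutoGroup)
  interpret \<phi>: group_hom H "AutoGroup N" \<phi>
    by unfold_locales (rule \<phi>)
  have auto: "\<phi> y \<in> auto N" if "y \<in> carrier H" for y
    using \<phi>.hom_closed[OF that] by (simp add: AutoGroup_def)
  have cl: "\<phi> y x \<in> carrier N" if "y \<in> carrier H" "x \<in> carrier N" for x y
    using auto[OF that(1)] that(2) by (auto simp: auto_def hom_def)
  have mult: "\<phi> y (x \<otimes>\<^bsub>N\<^esub> x') = \<phi> y x \<otimes>\<^bsub>N\<^esub> \<phi> y x'"
    if "y \<in> carrier H" "x \<in> carrier N" "x' \<in> carrier N" for x x' y
    using auto[OF that(1)] that(2-) by (auto simp: auto_def hom_def)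
  have comp: "\<phi> (y \<otimes>\<^bsub>H\<^esub> y') x = \<phi> y (\<phi> y' x)"
    if "y \<in> carrier H" "y' \<in> carrier H" "x \<in> carrier N" for x y y'
    using \<phi>.hom_mult[OF that(1,2)] auto[OF that(1)] auto[OF that(2)] that(3)
    by (auto simp: AutoGroup_def BijGroup_def auto_def compose_def)
  have one: "\<phi> \<one>\<^bsub>H\<^esub> x = x" if "x \<in> carrier N" for x
    using \<phi>.hom_one that by (simp add: AutoGroup_def BijGroup_def)
  show ?thesis
  proof (rule groupI)
    fix z assume "z \<in> carrier (semidirect_product N H \<phi>)"
    then obtain x y where z: "z = (x, y)" "x \<in> carrier N" "y \<in> carrier H"
      by (auto simp: semidirect_product_def)
    have "\<phi> (inv\<^bsub>H\<^esub> y) (inv\<^bsub>N\<^esub> x) \<otimes>\<^bsub>N\<^esub> \<phi> (inv\<^bsub>H\<^esub> y) x = \<one>\<^bsub>N\<^esub>"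
    proof -
      have "\<phi> (inv\<^bsub>H\<^esub> y) \<one>\<^bsub>N\<^esub> = \<phi> (inv\<^bsub>H\<^esub> y) \<one>\<^bsub>N\<^esub> \<otimes>\<^bsub>N\<^esub> \<phi> (inv\<^bsub>H\<^esub> y) \<one>\<^bsub>N\<^esub>"
        using mult[of "inv\<^bsub>H\<^esub> y" "\<one>\<^bsub>N\<^esub>" "\<one>\<^bsub>N\<^esub>"] z by simp
      then have "\<phi> (inv\<^bsub>H\<^esub> y) \<one>\<^bsub>N\<^esub> = \<one>\<^bsub>N\<^esub>"
        using cl[of "inv\<^bsub>H\<^esub> y" "\<one>\<^bsub>N\<^esub>"] z N.l_cancel_one' by simp
      then show ?thesis using mult[of "inv\<^bsub>H\<^esub> y" "inv\<^bsub>N\<^esub> x" x] z by simp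
    qed
    then show "\<exists>w\<in>carrier (semidirect_product N H \<phi>).
        w \<otimes>\<^bsub>semidirect_product N H \<phi>\<^esub> z = \<one>\<^bsub>semidirect_product N H \<phi>\<^esub>"
      using z cl by (intro bexI[of _ "(\<phi> (inv\<^bsub>H\<^esub> y) (inv\<^bsub>N\<^esub> x), inv\<^bsub>H\<^esub> y)"])
        (auto simp: semidirect_product_def simp del: \<phi>.hom_inv)
  qed (auto simp: semidirect_product_def cl mult comp one N.m_assoc H.m_assoc
    simp del: \<phi>.hom_mult \<phi>.hom_one)
qed


section \<open>The group under consideration\<close>

datatype generator = a | b | c

definition G_relations :: "nat \<Rightarrow> (generator word \<times> generator word) set" where
  "G_relations p =
    {(wpow (gen a) 4, []),
     (wpow (gen b) p, []),
     (wpow (gen c) p, []),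
     (wcommutator (gen a) (gen b), []),
     (wcommutator (gen b) (gen c), []),
     (winv (gen a) @ gen c @ gen a, winv (gen c))}"

hide_const (open) a b c

end

theory Submission
  imports Defs "HOL-Number_Theory.Residue_Primitive_Roots"
begin

text \<open>
  The relations say that \<open>b\<close> is central and that \<open>a\<close> inverts \<open>c\<close>, so every element
  of \<open>G\<close> is uniquely \<open>b\<^sup>i c\<^sup>j a\<^sup>k\<close> with \<open>i, j\<close> modulo \<open>p\<close> and \<open>k\<close> modulo \<open>4\<close>, and
  \<open>G\<close> is \<open>\<int>\<^sub>p \<times> (\<int>\<^sub>p \<rtimes> \<int>\<^sub>4)\<close> with \<open>\<int>\<^sub>4\<close> acting by inversion.
  Uniqueness of the normal form needs a group in which the words take distinct values;
  it is \<open>model p\<close>, and \<open>presented_group_iso_model\<close> identifies it with \<open>G\<close>.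

  An automorphism is determined by the images of the generators, and these are forced to be
  \<open>b \<mapsto> b\<^sup>u\<close>, \<open>c \<mapsto> c\<^sup>v\<close>, \<open>a \<mapsto> c\<^sup>s a\<^sup>\<epsilon>\<close> with \<open>u, v\<close> units modulo \<open>p\<close>, \<open>s\<close> modulo \<open>p\<close>
  and \<open>\<epsilon> = \<plusminus>1\<close> (\<open>model_hom_is_model_aut\<close>): the orders of \<open>b\<close> and \<open>c\<close> keep their images in
  \<open>\<langle>b, c\<rangle>\<close>, the image of \<open>c\<close> is inverted by the image of \<open>a\<close>, the image of \<open>b\<close> commutes with
  it, and \<open>a\<^sup>4 = 1\<close> excludes a factor \<open>b\<^sup>i\<close> in the image of \<open>a\<close>. Conversely all
  these choices give automorphisms (\<open>model_aut_iso\<close>).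

  Composing two of them multiplies the parameters \<open>u\<close>, \<open>v\<close> and \<open>\<epsilon>\<close>, and sends \<open>s, s'\<close> to
  \<open>s + v s'\<close> (\<open>model_aut_comp\<close>). The sign \<open>\<epsilon>\<close> does not act on \<open>s\<close> because
  \<open>(c\<^sup>s a)\<inverse> = c\<^sup>s a\<inverse>\<close>. So the automorphisms form
  \<open>\<int>\<^sub>p \<rtimes> ((\<int>\<^sub>p\<^sup>* \<times> \<int>\<^sub>p\<^sup>*) \<times> \<int>\<^sub>2)\<close>, where only the second factor acts, by
  multiplication; a primitive root modulo \<open>p\<close> turns \<open>\<int>\<^sub>p\<^sup>*\<close> into \<open>\<int>\<^bsub>p-1\<^esub>\<close>.
\<close>

section \<open>Powers of group elements\<close>

text \<open>
  Commutation (\<open>y = x\<close>) and inversion (\<open>y = inv x\<close>) relations both pass to all powers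
  of \<open>x\<close> through this single statement.
\<close>

lemma (in group) int_pow_intertwine:
  assumes w: "w \<in> carrier G" and x: "x \<in> carrier G" and y: "y \<in> carrier G"
    and wx: "w \<otimes> x = y \<otimes> w"
  shows "w \<otimes> x [^] (i::int) = y [^] i \<otimes> w"
proof -
  have nat: "w \<otimes> x [^] (n::nat) = y [^] n \<otimes> w" for n
  proof (induction n)
    case 0
    show ?case using w by simp
  next
    case (Suc n)
    have "w \<otimes> x [^] Suc n = (w \<otimes> x [^] n) \<otimes> x"
      using w x by (simp add: m_assoc)
    also have "\<dots> = y [^] n \<otimes> (w \<otimes> x)"
      unfolding Suc.IH using w x y by (simp add: m_assoc)
    also have "\<dots> = y [^] Suc n \<otimes> w"
      unfolding wx using w x y by (simp add: m_assoc)
    finally show ?case .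
  qed
  show ?thesis
  proof (cases i rule: int_cases2)
    case (nonneg n)
    then show ?thesis by (simp add: nat int_pow_int)
  next
    case (nonpos n)
    have "w \<otimes> inv (x [^] n) = inv (y [^] n) \<otimes> (y [^] n \<otimes> w) \<otimes> inv (x [^] n)"
      using w y x by (simp add: m_assoc[symmetric])
    also have "\<dots> = inv (y [^] n) \<otimes> w"
      unfolding nat[symmetric] using w y x by (simp add: m_assoc)
    finally show ?thesis using nonpos x y by (simp add: int_pow_neg_int)
  qed
qed

lemma (in group) int_pow_mod:
  assumes x: "x \<in> carrier G" and "x [^] n = \<one>"
  shows "x [^] (i mod int n) = x [^] i"
proof -
  have "x [^] i = x [^] (int n * (i div int n) + i mod int n)"
    by simp
  also have "\<dots> = (x [^] int n) [^] (i div int n) \<otimes> x [^] (i mod int n)"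
    using x by (simp only: int_pow_mult int_pow_pow)
  finally show ?thesis using assms by (simp add: int_pow_int)
qed

section \<open>Evaluating words\<close>

definition eval_word :: "('h, 'm) monoid_scheme \<Rightarrow> ('g \<Rightarrow> 'h) \<Rightarrow> 'g word \<Rightarrow> 'h" where
  "eval_word K f w =
    foldr (\<lambda>(x, e) y. (if e then f x else inv\<^bsub>K\<^esub> (f x)) \<otimes>\<^bsub>K\<^esub> y) w \<one>\<^bsub>K\<^esub>"

context group
begin

context
  fixes f :: "'g \<Rightarrow> 'a"
  assumes f: "f x \<in> carrier G"
begin

lemma eval_word_closed: "eval_word G f w \<in> carrier G"
  by (induction w) (auto simp: eval_word_def f)

lemma eval_word_append: "eval_word G f (v @ w) = eval_word G f v \<otimes> eval_word G f w"
proof (induction v)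
  case Nil
  then show ?case using eval_word_closed[of w] by (simp add: eval_word_def)
next
  case (Cons z v)
  have "eval_word G f (z # u) = (if snd z then f (fst z) else inv (f (fst z))) \<otimes> eval_word G f u" for u
    by (simp add: eval_word_def split_beta)
  then show ?case using Cons eval_word_closed by (simp add: f m_assoc)
qed

lemma eval_word_gen: "eval_word G f (gen x) = f x"
  by (simp add: eval_word_def gen_def f)

lemma eval_word_cancel: "eval_word G f [(x, e), (x, \<not> e)] = \<one>"
  by (simp add: eval_word_def f)

text \<open>
  The substitution half of von Dyck's theorem: a map of generators that satisfies the
  relations gives equal values to words that are equal in the presented group.
\<close>

lemma eval_word_respects:
  assumes R: "\<And>l r. (l, r) \<in> R \<Longrightarrow> eval_word G f l = eval_word G f r"
    and "word_eq R v w"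
  shows "eval_word G f v = eval_word G f w"
  using assms(2)
proof (induction rule: word_eq.induct)
  case (cancel u x e v)
  then show ?case
    by (simp only: eval_word_append eval_word_cancel l_one eval_word_closed)
next
  case (relation l r u v)
  then show ?case using R by (simp add: eval_word_append)
qed auto

lemma eval_word_winv: "eval_word G f (winv w) = inv (eval_word G f w)"
proof -
  have "eval_word G f (winv w @ w) = eval_word G f []"
    by (rule eval_word_respects[OF _ word_eq_winv_left[of "{}"]]) simp
  then show ?thesis
    by (intro inv_equality[symmetric])
      (auto simp: eval_word_append eval_word_closed, simp add: eval_word_def)
qed

lemma eval_word_wpow: "eval_word G f (wpow w n) = eval_word G f w [^] n"
proof (induction n)
  case 0
  then show ?case by (simp add: eval_word_def wpow_def)
next
  case (Suc n)
  have "wpow w (Suc n) = w @ wpow w n"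
    by (simp add: wpow_def)
  then show ?case using Suc nat_pow_Suc2[OF eval_word_closed, of w n] by (simp add: eval_word_append del: nat_pow_Suc)
qed

lemma eval_word_wcommutator:
  "eval_word G f (wcommutator v w) = \<one> \<longleftrightarrow>
     eval_word G f v \<otimes> eval_word G f w = eval_word G f w \<otimes> eval_word G f v"
proof -
  let ?x = "eval_word G f v" and ?y = "eval_word G f w"
  have c: "?x \<in> carrier G" "?y \<in> carrier G" by (rule eval_word_closed)+
  have "eval_word G f (wcommutator v w) = inv (?y \<otimes> ?x) \<otimes> (?x \<otimes> ?y)"
    using c by (simp add: wcommutator_def eval_word_append eval_word_winv inv_mult_group m_assoc)
  then show ?thesis
    using c by (metis inv_solve_left m_closed one_closed r_one)
qed

end

end

text \<open>
  Evaluation in the presented group itself is the quotient map, so the calculus of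
  \<open>eval_word\<close> also applies to word classes.
\<close>

lemma eval_word_class:
  "eval_word (presented_group R) (\<lambda>x. word_class R (gen x)) w = word_class R w"
proof (induction w)
  case Nil
  show ?case by (simp add: eval_word_def presented_group_def)
next
  case (Cons z w)
  interpret P: group "presented_group R" by (rule group_presented_group)
  obtain x e where z: "z = (x, e)" by force
  have cl: "word_class R v \<in> carrier (presented_group R)" for v
    by (simp add: presented_group_def)
  have "word_class R [(x, False)] \<otimes>\<^bsub>presented_group R\<^esub> word_class R (gen x) = word_class R []"
    using word_eq.cancel[of R "[]" x False "[]"]
    by (simp add: presented_group_mult gen_def word_class_eq_iff)
  then have "inv\<^bsub>presented_group R\<^esub> word_class R (gen x) = word_class R [(x, False)]"
    by (intro P.inv_equality) (simp_all add: cl, simp add: presented_group_def)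
  then have "eval_word (presented_group R) (\<lambda>x. word_class R (gen x)) (z # w)
      = word_class R [(x, e)] \<otimes>\<^bsub>presented_group R\<^esub> word_class R w"
    using Cons by (simp add: eval_word_def z gen_def)
  then show ?case by (simp add: presented_group_mult z)
qed

section \<open>Automorphism groups of isomorphic groups\<close>

lemma carrier_AutoGroup: "f \<in> carrier (AutoGroup G) \<longleftrightarrow>
    f \<in> extensional (carrier G) \<and> f \<in> hom G G \<and> bij_betw f (carrier G) (carrier G)"
  by (auto simp: AutoGroup_def auto_def Bij_def)

lemma mult_AutoGroup:
  "\<lbrakk>f \<in> carrier (AutoGroup G); g \<in> carrier (AutoGroup G)\<rbrakk> \<Longrightarrow>
    f \<otimes>\<^bsub>AutoGroup G\<^esub> g = compose (carrier G) f g"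
  by (auto simp: AutoGroup_def BijGroup_def auto_def)

lemma AutoGroup_eqI:
  assumes "f \<in> carrier (AutoGroup G)" "g \<in> carrier (AutoGroup G)"
    "\<And>x. x \<in> carrier G \<Longrightarrow> f x = g x"
  shows "f = g"
  using assms by (intro extensionalityI[of _ "carrier G"]) (auto simp: carrier_AutoGroup)

lemma restrict_in_AutoGroup:
  assumes "group G" "f \<in> iso G G"
  shows "restrict f (carrier G) \<in> carrier (AutoGroup G)"
proof -
  interpret group G by fact
  show ?thesis
    using assms(2) by (auto simp: carrier_AutoGroup iso_def hom_def Pi_def)
qed

lemma AutoGroup_closed:
  "\<lbrakk>f \<in> carrier (AutoGroup G); x \<in> carrier G\<rbrakk> \<Longrightarrow> f x \<in> carrier G"
  by (auto simp: carrier_AutoGroup hom_def)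

lemma AutoGroup_cong:
  assumes G: "group G" and K: "group K" and "G \<cong> K"
  shows "AutoGroup G \<cong> AutoGroup K"
proof -
  interpret group G by fact
  from \<open>G \<cong> K\<close> obtain h where h: "h \<in> iso G K" by (auto simp: is_iso_def)
  define h' where "h' = inv_into (carrier G) h"
  have h': "h' \<in> iso K G"
    unfolding h'_def using h by (rule iso_set_sym)
  have cl [simp]: "x \<in> carrier G \<Longrightarrow> h x \<in> carrier K" "y \<in> carrier K \<Longrightarrow> h' y \<in> carrier G" for x y
    using h h' by (auto simp: iso_def hom_def)
  have inv [simp]: "x \<in> carrier G \<Longrightarrow> h' (h x) = x" "y \<in> carrier K \<Longrightarrow> h (h' y) = y" for x y
    unfolding h'_def using h by (auto simp: iso_def bij_betw_inv_into_left bij_betw_inv_into_right)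
  define T where "T f = restrict (h \<circ> (f \<circ> h')) (carrier K)" for f
  define T' where "T' f = restrict (h' \<circ> (f \<circ> h)) (carrier G)" for f
  have T: "T f \<in> carrier (AutoGroup K)" if "f \<in> carrier (AutoGroup G)" for f
    unfolding T_def using that
    by (intro restrict_in_AutoGroup K iso_set_trans[OF iso_set_trans[OF h'] h])
      (auto simp: carrier_AutoGroup iso_def)
  have T': "T' f \<in> carrier (AutoGroup G)" if "f \<in> carrier (AutoGroup K)" for f
    unfolding T'_def using that
    by (intro restrict_in_AutoGroup G iso_set_trans[OF iso_set_trans[OF h] h'])
      (auto simp: carrier_AutoGroup iso_def)
  have "T \<in> hom (AutoGroup G) (AutoGroup K)"
  proof (rule homI)
    fix f g assume f: "f \<in> carrier (AutoGroup G)" and g: "g \<in> carrier (AutoGroup G)"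
    have "compose (carrier K) (T f) (T g) = T (compose (carrier G) f g)"
      using f g by (auto simp: T_def compose_def AutoGroup_closed restrict_def fun_eq_iff)
    then show "T (f \<otimes>\<^bsub>AutoGroup G\<^esub> g) = T f \<otimes>\<^bsub>AutoGroup K\<^esub> T g"
      using f g by (simp add: mult_AutoGroup T)
  qed (rule T)
  moreover have "bij_betw T (carrier (AutoGroup G)) (carrier (AutoGroup K))"
  proof (rule bij_betw_byWitness[where f' = T'])
    show "\<forall>f\<in>carrier (AutoGroup G). T' (T f) = f"
      by (auto intro!: AutoGroup_eqI[of _ G] T T') (auto simp: T_def T'_def AutoGroup_closed)
    show "\<forall>f\<in>carrier (AutoGroup K). T (T' f) = f"
      by (auto intro!: AutoGroup_eqI[of _ K] T T') (auto simp: T_def T'_def AutoGroup_closed)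
  qed (use T T' in auto)
  ultimately show ?thesis by (auto simp: iso_def intro: is_isoI)
qed

section \<open>The group of normal forms\<close>

text \<open>
  \<open>alt k x\<close> is \<open>(- 1)\<^sup>k x\<close>, meaningful for negative \<open>k\<close> as well. It is the exponent that
  \<open>c\<^sup>x\<close> acquires when \<open>a\<^sup>k\<close> is moved across it.
\<close>

definition alt :: "int \<Rightarrow> int \<Rightarrow> int" where
  "alt k j = (if even k then j else - j)"

text \<open>
  The triple \<open>(i, j, k)\<close> stands for \<open>b\<^sup>i c\<^sup>j a\<^sup>k\<close>; the product is the one forced by the relations.
\<close>

definition model :: "nat \<Rightarrow> (int \<times> int \<times> int) monoid" where
  "model p =
    \<lparr>carrier = {0..<int p} \<times> {0..<int p} \<times> {0..<4},
     monoid.mult = (\<lambda>(i, j, k) (i', j', k').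
       ((i + i') mod int p, (j + alt k j') mod int p, (k + k') mod 4)),
     one = (0, 0, 0)\<rparr>"

lemma carrier_model: "carrier (model p) = {0..<int p} \<times> {0..<int p} \<times> {0..<4}"
  by (simp add: model_def)

lemma carrier_modelE:
  assumes "m \<in> carrier (model p)"
  obtains i j k :: nat where "m = (int i, int j, int k)" "i < p" "j < p" "k < 4"
proof -
  obtain i j k where m: "m = (i, j, k)" by (cases m)
  then show ?thesis
    using assms by (intro that[of "nat i" "nat j" "nat k"]) (auto simp: carrier_model)
qed

lemma mult_model: "(i, j, k) \<otimes>\<^bsub>model p\<^esub> (i', j', k') =
    ((i + i') mod int p, (j + alt k j') mod int p, (k + k') mod 4)"
  by (simp add: model_def)

lemma one_model: "\<one>\<^bsub>model p\<^esub> = (0, 0, 0)"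
  by (simp add: model_def)

lemma alt_add: "alt k (x + y) = alt k x + alt k y"
  and alt_alt: "alt k (alt l x) = alt (k + l) x"
  and alt_minus: "alt (- k) x = alt k x"
  by (auto simp: alt_def)

lemma alt_mod_4: "alt (k mod 4) x = alt k x"
  by (simp add: alt_def dvd_mod_iff)

lemma alt_mod: "(y + alt k (x mod m)) mod m = (y + alt k x) mod m"
  by (simp add: alt_def mod_simps)

lemma group_model:
  assumes "p > 0"
  shows "group (model p)"
proof (rule groupI)
  fix x assume x: "x \<in> carrier (model p)"
  obtain i j k where ijk: "x = (i, j, k)" by (cases x)
  have "((-i) mod int p, (- alt k j) mod int p, (-k) mod 4) \<otimes>\<^bsub>model p\<^esub> x = \<one>\<^bsub>model p\<^esub>"
    unfolding ijk mult_model one_model alt_mod_4 alt_minus by (simp add: mod_simps)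
  then show "\<exists>y\<in>carrier (model p). y \<otimes>\<^bsub>model p\<^esub> x = \<one>\<^bsub>model p\<^esub>"
    using assms by (intro bexI[of _ "((-i) mod int p, (- alt k j) mod int p, (-k) mod 4)"])
      (auto simp: carrier_model)
next
  fix x y z :: "int \<times> int \<times> int"
  show "x \<otimes>\<^bsub>model p\<^esub> y \<otimes>\<^bsub>model p\<^esub> z = x \<otimes>\<^bsub>model p\<^esub> (y \<otimes>\<^bsub>model p\<^esub> z)"
    by (cases x; cases y; cases z)
      (simp add: mult_model alt_mod_4 alt_mod alt_add alt_alt mod_simps add.assoc)
qed (use assms in \<open>auto simp: carrier_model mult_model one_model alt_def\<close>)

lemma nat_pow_model_b: "(i, 0, 0) [^]\<^bsub>model p\<^esub> (n::nat) = ((i * int n) mod int p, 0, 0)"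
  by (induction n) (simp_all add: one_model mult_model alt_def mod_simps distrib_left add.commute)

lemma nat_pow_model_c: "(0, j, 0) [^]\<^bsub>model p\<^esub> (n::nat) = (0, (j * int n) mod int p, 0)"
  by (induction n) (simp_all add: one_model mult_model alt_def mod_simps distrib_left add.commute)

text \<open>
  Since \<open>k\<close> is odd, \<open>c\<^sup>s a\<^sup>k\<close> has square \<open>a\<^bsup>2k\<^esup>\<close>: the contributions of \<open>c\<^sup>s\<close> cancel in pairs.
\<close>

lemma nat_pow_model_a:
  assumes "odd k"
  shows "(0, s, k) [^]\<^bsub>model p\<^esub> (n::nat) =
    (0, (if even n then 0 else s) mod int p, (k * int n) mod 4)"
proof (induction n)
  case (Suc n)
  show ?case
    unfolding nat_pow_Suc Suc mult_model alt_mod_4 using assms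
    by (auto simp: alt_def mod_simps distrib_left add.commute)
qed (simp add: one_model)

text \<open>
  Normal forms multiply by the defining relations alone, so any triple of elements subject to
  these relations receives a homomorphism from the model.
\<close>

lemma model_hom:
  fixes K (structure)
  assumes "group K" and x: "x \<in> carrier K" and y: "y \<in> carrier K" and z: "z \<in> carrier K"
    and ox: "x [^] (4::nat) = \<one>" and oy: "y [^] p = \<one>" and oz: "z [^] p = \<one>"
    and xy: "x \<otimes> y = y \<otimes> x" and yz: "y \<otimes> z = z \<otimes> y" and zx: "z \<otimes> x = x \<otimes> inv z"
  shows "(\<lambda>(i::int, j::int, k::int). y [^] i \<otimes> z [^] j \<otimes> x [^] k) \<in> hom (model p) K"
proof -
  interpret group K by fact
  have "x \<otimes> z = inv z \<otimes> (z \<otimes> x) \<otimes> z"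
    using x z by (simp add: m_assoc[symmetric])
  also have "\<dots> = inv z \<otimes> x"
    unfolding zx using x z by (simp add: m_assoc)
  finally have xz: "x \<otimes> z = inv z \<otimes> x" .
  have yi_x: "y [^] i \<otimes> x [^] k = x [^] k \<otimes> y [^] i" for i k :: int
    using int_pow_intertwine[OF x y y xy, of i] x y by (intro int_pow_intertwine) auto
  have zj_y: "z [^] j \<otimes> y [^] i = y [^] i \<otimes> z [^] j" for i j :: int
    using int_pow_intertwine[OF y z z yz, of j] z y
    by (intro int_pow_intertwine) auto
  have step: "x \<otimes> z [^] j = z [^] (- j) \<otimes> x" for j :: int
    using int_pow_intertwine[OF x z _ xz, of j] z by (simp add: int_pow_inv int_pow_neg)
  have xn_z: "x [^] n \<otimes> z [^] j = z [^] alt (int n) j \<otimes> x [^] n" for n :: nat and j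
  proof (induction n arbitrary: j)
    case 0
    then show ?case using z by (simp add: alt_def)
  next
    case (Suc n)
    have "x [^] Suc n \<otimes> z [^] j = x [^] n \<otimes> z [^] (- j) \<otimes> x"
      using x z by (simp add: m_assoc step)
    also have "\<dots> = z [^] alt (int n) (- j) \<otimes> x [^] Suc n"
      unfolding Suc using x z by (simp add: m_assoc)
    finally show ?case by (simp add: alt_def)
  qed
  have red: "x [^] (k mod 4) = x [^] k" "y [^] (k mod int p) = y [^] k" "z [^] (k mod int p) = z [^] k" for k
    using int_pow_mod[OF x ox] int_pow_mod[OF y oy] int_pow_mod[OF z oz] by auto
  show ?thesis
  proof (rule homI)
    fix m m' assume "m \<in> carrier (model p)" "m' \<in> carrier (model p)"
    then obtain i j k i' j' k' where m: "m = (i, j, int k)" "m' = (i', j', k')"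
      by (metis carrier_modelE)
    have "y [^] i \<otimes> z [^] j \<otimes> x [^] int k \<otimes> (y [^] i' \<otimes> z [^] j' \<otimes> x [^] k')
      = y [^] i \<otimes> (z [^] j \<otimes> (x [^] int k \<otimes> y [^] i') \<otimes> z [^] j') \<otimes> x [^] k'"
      using x y z by (simp add: m_assoc)
    also have "\<dots> = y [^] i \<otimes> (z [^] j \<otimes> y [^] i') \<otimes> (x [^] int k \<otimes> z [^] j') \<otimes> x [^] k'"
      unfolding yi_x[symmetric] using x y z by (simp add: m_assoc)
    also have "\<dots> = (y [^] i \<otimes> y [^] i') \<otimes> (z [^] j \<otimes> z [^] alt (int k) j') \<otimes> (x [^] int k \<otimes> x [^] k')"
      unfolding zj_y int_pow_int xn_z using x y z by (simp add: m_assoc)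
    finally show "(case m \<otimes>\<^bsub>model p\<^esub> m' of (i, j, k) \<Rightarrow> y [^] i \<otimes> z [^] j \<otimes> x [^] k)
      = (case m of (i, j, k) \<Rightarrow> y [^] i \<otimes> z [^] j \<otimes> x [^] k) \<otimes>
        (case m' of (i, j, k) \<Rightarrow> y [^] i \<otimes> z [^] j \<otimes> x [^] k)"
      using x y z by (simp add: m mult_model red int_pow_mult)
  qed (use x y z in auto)
qed

section \<open>The presented group is the model\<close>

lemma (in group) G_relations_hold_iff:
  assumes f: "\<And>s. f s \<in> carrier G"
  shows "(\<forall>(l, r) \<in> G_relations p. eval_word G f l = eval_word G f r) \<longleftrightarrow>
    f generator.a [^] (4::nat) = \<one> \<and> f generator.b [^] p = \<one> \<and> f generator.c [^] p = \<one> \<and>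
    f generator.a \<otimes> f generator.b = f generator.b \<otimes> f generator.a \<and>
    f generator.b \<otimes> f generator.c = f generator.c \<otimes> f generator.b \<and>
    f generator.c \<otimes> f generator.a = f generator.a \<otimes> inv (f generator.c)"
proof -
  have "inv (f generator.a) \<otimes> (f generator.c \<otimes> f generator.a) = inv (f generator.c) \<longleftrightarrow>
      f generator.c \<otimes> f generator.a = f generator.a \<otimes> inv (f generator.c)"
    using f by (metis inv_closed inv_solve_left m_closed)
  moreover have "eval_word G f [] = \<one>"
    by (simp add: eval_word_def)
  ultimately show ?thesis
    unfolding G_relations_def
    by (simp add: eval_word_append eval_word_gen eval_word_winv eval_word_wpow eval_word_wcommutator f)
qed

fun model_gen :: "generator \<Rightarrow> int \<times> int \<times> int" where
  "model_gen generator.a = (0, 0, 1)"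
| "model_gen generator.b = (1, 0, 0)"
| "model_gen generator.c = (0, 1, 0)"

text \<open>
  The map \<open>(i, j, k) \<mapsto> b\<^sup>i c\<^sup>j a\<^sup>k\<close> is a homomorphism onto \<open>G\<close>, since its image is a
  subgroup containing the generators. It is injective because evaluating the
  word \<open>b\<^sup>i c\<^sup>j a\<^sup>k\<close> in the model recovers \<open>(i, j, k)\<close>.
\<close>

lemma presented_group_iso_model:
  assumes "p > 1"
  shows "model p \<cong> presented_group (G_relations p)"
proof -
  let ?R = "G_relations p" and ?P = "presented_group (G_relations p)" and ?M = "model p"
  interpret M: group ?M using assms by (intro group_model) simp
  interpret P: group ?P by (rule group_presented_group)
  define g where "g s = word_class ?R (gen s)" for s
  define ev where "ev = eval_word ?P g"
  have g: "g s \<in> carrier ?P" for s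
    by (simp add: g_def presented_group_def)
  have ev_eq: "ev w = word_class ?R w" for w
    unfolding ev_def g_def by (rule eval_word_class)
  have ev_Nil: "ev [] = \<one>\<^bsub>?P\<^esub>" by (simp add: ev_def eval_word_def)
  have "ev l = ev r" if "(l, r) \<in> ?R" for l r
    using word_eq.relation[OF that, of "[]" "[]"] by (simp add: ev_eq word_class_eq_iff)
  then have g_rel: "\<forall>(l, r) \<in> ?R. eval_word ?P g l = eval_word ?P g r"
    by (auto simp: ev_def)
  define \<psi> where "\<psi> = (\<lambda>(i::int, j::int, k::int).
    g generator.b [^]\<^bsub>?P\<^esub> i \<otimes>\<^bsub>?P\<^esub> g generator.c [^]\<^bsub>?P\<^esub> j \<otimes>\<^bsub>?P\<^esub> g generator.a [^]\<^bsub>?P\<^esub> k)"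
  have g_rel': "g generator.a [^]\<^bsub>?P\<^esub> (4::nat) = \<one>\<^bsub>?P\<^esub>"
    "g generator.b [^]\<^bsub>?P\<^esub> p = \<one>\<^bsub>?P\<^esub>" "g generator.c [^]\<^bsub>?P\<^esub> p = \<one>\<^bsub>?P\<^esub>"
    "g generator.a \<otimes>\<^bsub>?P\<^esub> g generator.b = g generator.b \<otimes>\<^bsub>?P\<^esub> g generator.a"
    "g generator.b \<otimes>\<^bsub>?P\<^esub> g generator.c = g generator.c \<otimes>\<^bsub>?P\<^esub> g generator.b"
    "g generator.c \<otimes>\<^bsub>?P\<^esub> g generator.a = g generator.a \<otimes>\<^bsub>?P\<^esub> inv\<^bsub>?P\<^esub> g generator.c"
    using g_rel[unfolded P.G_relations_hold_iff[of g, OF g]] by blast+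
  have hom: "\<psi> \<in> hom ?M ?P"
    unfolding \<psi>_def by (rule model_hom[OF group_presented_group g g g g_rel'])
  interpret \<psi>: group_hom ?M ?P \<psi> by unfold_locales (rule hom)

  have M_gen: "model_gen s \<in> carrier ?M" for s
    using assms by (cases s) (auto simp: carrier_model)
  define mv where "mv = eval_word ?M model_gen"
  have M_pow: "model_gen generator.b [^]\<^bsub>?M\<^esub> (n::nat) = (int n mod int p, 0, 0)"
    "model_gen generator.c [^]\<^bsub>?M\<^esub> (n::nat) = (0, int n mod int p, 0)"
    "model_gen generator.a [^]\<^bsub>?M\<^esub> (n::nat) = (0, 0, int n mod 4)" for n
    by (simp_all add: nat_pow_model_b nat_pow_model_c nat_pow_model_a)
  have inv_c: "inv\<^bsub>?M\<^esub> (0, 1, 0) = (0, (-1) mod int p, 0)"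
    using assms M_gen[of generator.c]
    by (intro M.inv_equality) (auto simp: mult_model one_model alt_def carrier_model mod_simps)
  have rel: "\<forall>(l, r) \<in> ?R. eval_word ?M model_gen l = eval_word ?M model_gen r"
    unfolding M.G_relations_hold_iff[of model_gen, OF M_gen] M_pow
    by (simp add: one_model inv_c mult_model alt_def mod_simps)
  have mv_respects: "mv v = mv w" if "word_class ?R v = word_class ?R w" for v w
    unfolding mv_def
  proof (rule M.eval_word_respects[OF M_gen])
    show "word_eq ?R v w" using that by (simp add: word_class_eq_iff)
  qed (use rel in blast)

  define nf where "nf = (\<lambda>(i, j, k).
    wpow (gen generator.b) (nat i) @ wpow (gen generator.c) (nat j) @ wpow (gen generator.a) (nat k))"
  have \<psi>_nf: "\<psi> m = word_class ?R (nf m)" if "m \<in> carrier ?M" for m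
    using that g unfolding ev_eq[symmetric] ev_def
    by (auto simp: \<psi>_def nf_def P.eval_word_append P.eval_word_gen P.eval_word_wpow carrier_model P.m_assoc simp flip: int_pow_int)
  have mv_nf: "mv (nf m) = m" if "m \<in> carrier ?M" for m
  proof -
    obtain i j k where m: "m = (int i, int j, int k)"
      by (rule carrier_modelE[OF \<open>m \<in> carrier ?M\<close>])
    have "mv (nf m) = model_gen generator.b [^]\<^bsub>?M\<^esub> i \<otimes>\<^bsub>?M\<^esub>
        (model_gen generator.c [^]\<^bsub>?M\<^esub> j \<otimes>\<^bsub>?M\<^esub> model_gen generator.a [^]\<^bsub>?M\<^esub> k)"
      by (simp add: m nf_def mv_def M.eval_word_append M.eval_word_gen M.eval_word_wpow M_gen
          del: model_gen.simps)
    also have "\<dots> = m"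
      unfolding M_pow using that by (simp add: m mult_model alt_def carrier_model)
    finally show ?thesis .
  qed
  have inj: "inj_on \<psi> (carrier ?M)"
  proof (rule inj_onI)
    fix m n assume mn: "m \<in> carrier ?M" "n \<in> carrier ?M" and "\<psi> m = \<psi> n"
    then have "mv (nf m) = mv (nf n)" by (intro mv_respects) (simp add: \<psi>_nf)
    then show "m = n" using mn by (simp add: mv_nf)
  qed

  have sub: "subgroup (\<psi> ` carrier ?M) ?P" by (rule \<psi>.img_is_subgroup)
  have g_img: "g s \<in> \<psi> ` carrier ?M" for s
  proof -
    have "\<psi> (model_gen s) = g s" using g by (cases s) (auto simp: \<psi>_def)
    then show ?thesis using M_gen[of s] by (metis imageI)
  qed
  have "ev w \<in> \<psi> ` carrier ?M" for w
  proof (induction w)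
    case Nil
    then show ?case using subgroup.one_closed[OF sub] by (simp add: ev_Nil)
  next
    case (Cons z w)
    have "ev (z # w) = (if snd z then g (fst z) else inv\<^bsub>?P\<^esub> g (fst z)) \<otimes>\<^bsub>?P\<^esub> ev w"
      by (simp add: ev_def eval_word_def split_beta)
    moreover have "(if snd z then g (fst z) else inv\<^bsub>?P\<^esub> g (fst z)) \<in> \<psi> ` carrier ?M"
      using g_img[of "fst z"] subgroup.m_inv_closed[OF sub] by simp
    ultimately show ?case
      using subgroup.m_closed[OF sub _ Cons.IH] by simp
  qed
  then have "carrier ?P \<subseteq> \<psi> ` carrier ?M"
    by (auto simp: ev_eq presented_group_def)
  then have "\<psi> ` carrier ?M = carrier ?P" by auto
  then have "\<psi> \<in> iso ?M ?P" using hom inj by (simp add: iso_iff)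
  then show ?thesis by (rule is_isoI)
qed

section \<open>Multiplication by units modulo a prime\<close>

lemma mult_mod_eq_0:
  fixes x :: int
  assumes "coprime u m" "u * x mod m = 0" "0 \<le> x" "x < m"
  shows "x = 0"
proof -
  have "m dvd x"
    using assms(1,2) by (metis coprime_commute coprime_dvd_mult_right_iff dvd_eq_mod_eq_0)
  then show ?thesis using assms(3,4) zdvd_imp_le by force
qed

lemma bij_betw_mult_mod:
  fixes u m :: int
  assumes "coprime u m" "m > 0"
  shows "bij_betw (\<lambda>x. u * x mod m) {0..<m} {0..<m}"
proof -
  have "inj_on (\<lambda>x. u * x mod m) {0..<m}"
  proof (rule inj_onI)
    fix x y assume x: "x \<in> {0..<m}" "y \<in> {0..<m}" and "u * x mod m = u * y mod m"
    then have "[x = y] (mod m)"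
      using assms(1) by (simp add: cong_def[symmetric] cong_mult_lcancel)
    then show "x = y" using x by (simp add: cong_def)
  qed
  moreover have "(\<lambda>x. u * x mod m) ` {0..<m} \<subseteq> {0..<m}"
    using assms(2) by auto
  ultimately show ?thesis
    by (simp add: bij_betw_def endo_inj_surj)
qed

text \<open>
  Powers of a primitive root: \<open>w x\<close> is \<open>g\<^sup>x\<close> modulo \<open>p\<close>.
\<close>

lemma ex_discrete_exponential:
  assumes "prime p"
  obtains w :: "int \<Rightarrow> int"
    where "bij_betw w (carrier (integer_mod_group (p - 1))) {1..<int p}"
      and "\<And>x y. \<lbrakk>x \<in> carrier (integer_mod_group (p - 1)); y \<in> carrier (integer_mod_group (p - 1))\<rbrakk>
        \<Longrightarrow> w (x \<otimes>\<^bsub>integer_mod_group (p - 1)\<^esub> y) = w x * w y mod int p"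
proof -
  have p: "p > 1" using assms by (rule prime_gt_1_nat)
  from prime_primitive_root_exists[OF p assms] obtain g where g: "residue_primroot p g" ..
  define w where "w x = int (g ^ nat x mod p)" for x
  have carr: "carrier (integer_mod_group (p - 1)) = int ` {..<p - 1}"
    using p by (simp add: carrier_integer_mod_group lessThan_atLeast0 image_int_atLeastLessThan)
  have "totatives p = {1..<p}"
    using assms totatives_prime by auto
  then have b: "bij_betw (\<lambda>i. g ^ i mod p) {..<p - 1} {1..<p}"
    using residue_primroot_is_generator[OF p g] assms by (simp add: totient_prime)
  show ?thesis
  proof (rule that[of w])
    have "bij_betw (int \<circ> (\<lambda>i. g ^ i mod p) \<circ> nat) (int ` {..<p - 1}) (int ` {1..<p})"
      by (intro bij_betw_trans[of _ _ "{..<p - 1}"] bij_betw_trans[OF _ _ , of _ _ "{1..<p}"] b)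
         (auto simp: bij_betw_def inj_on_def image_image)
    moreover have "int ` {1..<p} = {1..<int p}"
      by (simp add: image_int_atLeastLessThan)
    ultimately show "bij_betw w (carrier (integer_mod_group (p - 1))) {1..<int p}"
      unfolding carr w_def[abs_def] by (simp add: comp_def del: One_nat_def)
  next
    fix x y assume "x \<in> carrier (integer_mod_group (p - 1))" "y \<in> carrier (integer_mod_group (p - 1))"
    then obtain m n where mn: "x = int m" "y = int n" by (auto simp: carr simp del: One_nat_def)
    have ord: "ord p g = p - 1"
      using g assms by (simp add: residue_primroot_def totient_prime)
    have "coprime p g" using g by (simp add: residue_primroot_def)
    then have "[g ^ ((m + n) mod (p - 1)) = g ^ (m + n)] (mod p)"
      by (subst order_divides_expdiff) (simp_all add: ord cong_def)
    then have "g ^ ((m + n) mod (p - 1)) mod p = (g ^ m mod p) * (g ^ n mod p) mod p"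
      by (simp add: cong_def power_add mod_simps)
    then show "w (x \<otimes>\<^bsub>integer_mod_group (p - 1)\<^esub> y) = w x * w y mod int p"
      unfolding w_def mn mult_integer_mod_group
      by (metis nat_int of_nat_add of_nat_mod of_nat_mult)
  qed
qed

section \<open>Automorphisms of the model\<close>

lemma mod_mult_add:
  fixes x y z m :: int
  shows "(x * (y mod m) + z) mod m = (x * y + z) mod m" "(z + x * (y mod m)) mod m = (z + x * y) mod m"
    "((y mod m) * x + z) mod m = (y * x + z) mod m"
  by (metis mod_add_left_eq mod_mult_right_eq, metis mod_add_right_eq mod_mult_right_eq,
      metis mod_add_left_eq mod_mult_left_eq)

text \<open>
  The automorphism \<open>b \<mapsto> b\<^sup>u\<close>, \<open>c \<mapsto> c\<^sup>v\<close>, \<open>a \<mapsto> c\<^sup>s a\<^sup>\<epsilon>\<close> on normal forms, where \<open>\<epsilon> = (- 1)\<^sup>e\<close>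
  and \<open>e\<close> is read modulo \<open>2\<close>. The power \<open>(c\<^sup>s a\<^sup>\<epsilon>)\<^sup>k\<close> contributes \<open>c\<^sup>s\<close> exactly for odd \<open>k\<close>.
\<close>

definition model_aut :: "nat \<Rightarrow> int \<Rightarrow> int \<Rightarrow> int \<Rightarrow> int \<Rightarrow> int \<times> int \<times> int \<Rightarrow> int \<times> int \<times> int" where
  "model_aut p u v s e = (\<lambda>(i, j, k).
    (u * i mod int p, (v * j + (if even k then 0 else s)) mod int p, alt e k mod 4))"

lemma even_alt: "even (alt k x) \<longleftrightarrow> even x"
  by (simp add: alt_def)

lemma even_mod_4: "even (k mod 4) \<longleftrightarrow> even (k::int)"
  by (simp add: dvd_mod_iff)

lemma alt_mod': "alt k (x mod m) mod m = alt k x mod m"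
  by (simp add: alt_def mod_simps)

lemma alt_even_cong: "(even k \<longleftrightarrow> even l) \<Longrightarrow> alt k x = alt l x"
  by (simp add: alt_def)

text \<open>
  What makes it multiplicative in the middle coordinate is that the contribution \<open>t k\<close> of \<open>c\<^sup>s\<close> is a
  crossed homomorphism: \<open>t (k + k') = t k + (- 1)\<^sup>k t k'\<close>.
\<close>

lemma model_aut_hom:
  assumes "p > 0"
  shows "model_aut p u v s e \<in> hom (model p) (model p)"
proof (rule homI)
  fix m m' :: "int \<times> int \<times> int"
  obtain i j k i' j' k' where m: "m = (i, j, k)" "m' = (i', j', k')"
    by (cases m; cases m')
  define t where "t k = (if even k then 0 else s)" for k :: int
  have t: "t ((k + k') mod 4) = t k + alt k (t k')"
    by (auto simp: t_def alt_def even_mod_4)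
  have arith: "v * (j + alt k j') + (t k + alt k (t k')) = v * j + t k + alt k (v * j' + t k')"
    by (simp add: alt_def algebra_simps)
  have "(v * ((j + alt k j') mod int p) + t ((k + k') mod 4)) mod int p
      = ((v * j + t k) mod int p + alt (alt e k mod 4) ((v * j' + t k') mod int p)) mod int p"
    unfolding t alt_mod_4 alt_mod alt_even_cong[OF even_alt] mod_mult_add mod_add_left_eq arith ..
  then show "model_aut p u v s e (m \<otimes>\<^bsub>model p\<^esub> m') =
      model_aut p u v s e m \<otimes>\<^bsub>model p\<^esub> model_aut p u v s e m'"
    by (simp add: m model_aut_def mult_model alt_mod' alt_add mod_simps distrib_left flip: t_def)
qed (use assms in \<open>auto simp: model_aut_def carrier_model\<close>)

lemma model_aut_iso:
  assumes p: "p > 0" and "coprime u (int p)" "coprime v (int p)"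
  shows "model_aut p u v s e \<in> iso (model p) (model p)"
proof -
  have inj: "inj_on (model_aut p u v s e) (carrier (model p))"
  proof (rule inj_onI)
    fix m m' assume m: "m \<in> carrier (model p)" "m' \<in> carrier (model p)"
      and eq: "model_aut p u v s e m = model_aut p u v s e m'"
    obtain i j k i' j' k' where ijk: "m = (i, j, k)" "m' = (i', j', k')"
      by (cases m; cases m')
    have cancel: "x = y" if "x \<in> {0..<int p}" "y \<in> {0..<int p}" "u * x mod int p = u * y mod int p"
      "coprime u (int p)" for x y u
      using bij_betw_mult_mod[OF that(4)] p that by (auto simp: bij_betw_def dest: inj_onD)
    have "i = i'" using cancel[of i i' u] m eq assms by (simp add: ijk model_aut_def carrier_model)
    moreover have "alt e k mod 4 = alt e k' mod 4"
      using eq by (simp add: ijk model_aut_def)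
    \<comment> \<open>Twisting by \<open>e\<close> is an involution.\<close>
    then have "alt e (alt e k mod 4) mod 4 = alt e (alt e k' mod 4) mod 4" by simp
    then have "k = k'"
      using m unfolding alt_mod' alt_alt by (simp add: alt_def ijk carrier_model)
    moreover from this have "[v * j + (if even k then 0 else s) = v * j' + (if even k then 0 else s)] (mod int p)"
      using eq by (simp add: ijk model_aut_def cong_def)
    then have "[v * j = v * j'] (mod int p)"
      by (simp only: cong_add_rcancel)
    then have "v * j mod int p = v * j' mod int p"
      by (simp only: cong_def)
    then have "j = j'" using cancel[of j j' v] m assms by (simp add: ijk carrier_model)
    ultimately show "m = m'" by (simp add: ijk)
  qed
  moreover have "finite (carrier (model p))" by (simp add: carrier_model)
  moreover have hom: "model_aut p u v s e \<in> hom (model p) (model p)"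
    using p by (rule model_aut_hom)
  ultimately have "model_aut p u v s e ` carrier (model p) = carrier (model p)"
    by (intro endo_inj_surj hom_carrier)
  with hom inj show ?thesis by (simp add: iso_iff)
qed

lemma model_aut_comp:
  "model_aut p u v s e (model_aut p u' v' s' e' m) =
    model_aut p (u * u' mod int p) (v * v' mod int p) ((s + v * s' mod int p) mod int p) ((e + e') mod 2) m"
proof -
  obtain i j k where m: "m = (i, j, k)" by (cases m)
  have "alt ((e + e') mod 2) k = alt e (alt e' k)"
    by (auto simp: alt_def)
  then show ?thesis
    by (simp add: m model_aut_def even_alt even_mod_4 alt_mod' mod_mult_add mod_simps
        distrib_left mult.assoc add.assoc add.commute add.left_commute)
qed

lemma fst_nat_pow_model: "fst (x [^]\<^bsub>model p\<^esub> (n::nat)) = int n * fst x mod int p"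
proof (induction n)
  case (Suc n)
  then show ?case
    by (cases x; cases "x [^]\<^bsub>model p\<^esub> n") (simp add: mult_model mod_simps distrib_right add.commute)
qed (simp add: one_model)

lemma snd_nat_pow_model: "snd (snd (x [^]\<^bsub>model p\<^esub> (n::nat))) = int n * snd (snd x) mod 4"
proof (induction n)
  case (Suc n)
  then show ?case
    by (cases x; cases "x [^]\<^bsub>model p\<^esub> n") (simp add: mult_model mod_simps distrib_right add.commute)
qed (simp add: one_model)

text \<open>
  The images of the generators satisfy the same relations, which make their
  unwanted coordinates vanish because \<open>2\<close>, \<open>4\<close> and \<open>p\<close> are suitably coprime. Injectivity enters only through \<open>f b \<noteq> 1\<close> and \<open>f c \<noteq> 1\<close>; the latter also forces
  \<open>f a\<close> to have an odd exponent of \<open>a\<close>, as otherwise \<open>f c\<close> would be its own inverse.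
\<close>

lemma model_hom_is_model_aut:
  assumes p: "prime p" "p \<noteq> 2"
    and hom: "f \<in> hom (model p) (model p)" and inj: "inj_on f (carrier (model p))"
  obtains u v s e where "u \<in> {1..<int p}" "v \<in> {1..<int p}" "s \<in> {0..<int p}" "e \<in> {0..<2}"
    and "\<And>m. m \<in> carrier (model p) \<Longrightarrow> f m = model_aut p u v s e m"
proof -
  have p2: "p > 2" using prime_ge_2_nat[OF p(1)] p(2) by linarith
  let ?M = "model p"
  interpret M: group ?M using p2 by (intro group_model) simp
  interpret f: group_hom ?M ?M f by unfold_locales (rule hom)
  have "odd p" using p p2 by (simp add: prime_odd_nat)
  then have cop2: "coprime 2 (int p)" by simp
  then have cop4: "coprime 4 (int p)" using coprime_power_left_iff[of 2 2 "int p"] by simp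
  then have cop4': "coprime (int p) 4" by (simp add: coprime_commute)
  have gens: "(0, 0, 1) \<in> carrier ?M" "(1, 0, 0) \<in> carrier ?M" "(0, 1, 0) \<in> carrier ?M"
    using p2 by (auto simp: carrier_model)
  obtain i\<^sub>a j\<^sub>a k\<^sub>a where fa: "f (0, 0, 1) = (i\<^sub>a, j\<^sub>a, k\<^sub>a)" by (cases "f (0, 0, 1)")
  obtain i\<^sub>b j\<^sub>b k\<^sub>b where fb: "f (1, 0, 0) = (i\<^sub>b, j\<^sub>b, k\<^sub>b)" by (cases "f (1, 0, 0)")
  obtain i\<^sub>c j\<^sub>c k\<^sub>c where fc: "f (0, 1, 0) = (i\<^sub>c, j\<^sub>c, k\<^sub>c)" by (cases "f (0, 1, 0)")
  note fg = fa fb fc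
  have bnd: "(i\<^sub>a, j\<^sub>a, k\<^sub>a) \<in> carrier ?M" "(i\<^sub>b, j\<^sub>b, k\<^sub>b) \<in> carrier ?M" "(i\<^sub>c, j\<^sub>c, k\<^sub>c) \<in> carrier ?M"
    using gens[THEN f.hom_closed] by (simp_all add: fg)
  have f_pow: "f (m [^]\<^bsub>?M\<^esub> (n::nat)) = f m [^]\<^bsub>?M\<^esub> n" if "m \<in> carrier ?M" for m n
    using that by (rule f.hom_nat_pow)
  have f1: "f (0, 0, 0) = (0, 0, 0)" using f.hom_one by (simp add: one_model)

  \<comment> \<open>The orders of the generators; \<open>p\<close> is prime to \<open>4\<close>.\<close>
  have "f (1, 0, 0) [^]\<^bsub>?M\<^esub> p = (0, 0, 0)" "f (0, 1, 0) [^]\<^bsub>?M\<^esub> p = (0, 0, 0)"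
    "f (0, 0, 1) [^]\<^bsub>?M\<^esub> (4::nat) = (0, 0, 0)"
    unfolding gens[THEN f_pow, symmetric] nat_pow_model_b nat_pow_model_c nat_pow_model_a[OF odd_one]
    by (simp_all add: f1)
  then have "int p * k\<^sub>b mod 4 = 0" "int p * k\<^sub>c mod 4 = 0" "4 * i\<^sub>a mod int p = 0"
    using snd_nat_pow_model[of p "f (1, 0, 0)" p] snd_nat_pow_model[of p "f (0, 1, 0)" p]
      fst_nat_pow_model[of p "f (0, 0, 1)" 4] by (simp_all add: fg)
  then have zero1: "k\<^sub>b = 0" "k\<^sub>c = 0" "i\<^sub>a = 0"
    using mult_mod_eq_0[OF cop4', of k\<^sub>b] mult_mod_eq_0[OF cop4', of k\<^sub>c]
      mult_mod_eq_0[OF cop4, of i\<^sub>a] bnd by (simp_all add: carrier_model)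

  \<comment> \<open>The relation \<open>a\<inverse> c a = c\<inverse>\<close> in the inverse-free form \<open>c a c = a\<close>.\<close>
  have "f ((0, 1, 0) \<otimes>\<^bsub>?M\<^esub> ((0, 0, 1) \<otimes>\<^bsub>?M\<^esub> (0, 1, 0))) = f (0, 0, 1)"
    using p2 by (simp add: mult_model alt_def mod_simps)
  then have "f (0, 1, 0) \<otimes>\<^bsub>?M\<^esub> (f (0, 0, 1) \<otimes>\<^bsub>?M\<^esub> f (0, 1, 0)) = f (0, 0, 1)"
    using gens by simp
  then have "((i\<^sub>c + i\<^sub>c mod int p) mod int p, (j\<^sub>c + (j\<^sub>a + alt k\<^sub>a j\<^sub>c) mod int p) mod int p) = (0, j\<^sub>a)"
    by (simp add: fg mult_model zero1 alt_def)
  then have c: "2 * i\<^sub>c mod int p = 0" "(j\<^sub>c + (j\<^sub>a + alt k\<^sub>a j\<^sub>c)) mod int p = j\<^sub>a"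
    unfolding mod_add_right_eq mult_2 by simp_all
  have "i\<^sub>c = 0"
    using mult_mod_eq_0[OF cop2 c(1)] bnd by (simp add: carrier_model)
  have "j\<^sub>c \<noteq> 0"
  proof
    assume "j\<^sub>c = 0"
    then have "f (0, 1, 0) = f (0, 0, 0)" using f1 fg zero1 \<open>i\<^sub>c = 0\<close> by simp
    then show False using inj_onD[OF inj _ gens(3) M.one_closed[unfolded one_model]] by simp
  qed
  have "odd k\<^sub>a"
  proof
    assume "even k\<^sub>a"
    then have "(j\<^sub>a + 2 * j\<^sub>c) mod int p = (j\<^sub>a + 0) mod int p"
      using c(2) bnd by (simp add: alt_def carrier_model algebra_simps)
    then have "[2 * j\<^sub>c = 0] (mod int p)" by (simp only: cong_def[symmetric] cong_add_lcancel)
    then have "j\<^sub>c = 0"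
      using mult_mod_eq_0[OF cop2, of j\<^sub>c] bnd by (simp add: carrier_model cong_def)
    with \<open>j\<^sub>c \<noteq> 0\<close> show False ..
  qed

  have "f ((0, 0, 1) \<otimes>\<^bsub>?M\<^esub> (1, 0, 0)) = f ((1, 0, 0) \<otimes>\<^bsub>?M\<^esub> (0, 0, 1))"
    by (simp add: mult_model alt_def)
  then have "f (0, 0, 1) \<otimes>\<^bsub>?M\<^esub> f (1, 0, 0) = f (1, 0, 0) \<otimes>\<^bsub>?M\<^esub> f (0, 0, 1)"
    using gens by simp
  then have "(j\<^sub>a - j\<^sub>b) mod int p = (j\<^sub>b + j\<^sub>a) mod int p"
    using \<open>odd k\<^sub>a\<close> by (simp add: fg mult_model zero1 alt_def)
  then have "[(j\<^sub>a - j\<^sub>b) + 0 = (j\<^sub>a - j\<^sub>b) + 2 * j\<^sub>b] (mod int p)"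
    by (simp add: cong_def algebra_simps)
  then have "[0 = 2 * j\<^sub>b] (mod int p)" by (simp only: cong_add_lcancel)
  then have "j\<^sub>b = 0"
    using mult_mod_eq_0[OF cop2, of j\<^sub>b] bnd by (simp add: carrier_model cong_def)
  have "i\<^sub>b \<noteq> 0"
  proof
    assume "i\<^sub>b = 0"
    then have "f (1, 0, 0) = f (0, 0, 0)" using f1 fg zero1 \<open>j\<^sub>b = 0\<close> by simp
    then show False using inj_onD[OF inj _ gens(2) M.one_closed[unfolded one_model]] by simp
  qed

  define e :: int where "e = (if k\<^sub>a = 1 then 0 else 1)"
  have "k\<^sub>a = 1 \<or> k\<^sub>a = 3"
    using \<open>odd k\<^sub>a\<close> bnd(1) unfolding carrier_model by simp presburger
  then have ka: "k\<^sub>a * k mod 4 = alt e k mod 4" for k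
    unfolding e_def alt_def by auto presburger
  have "f m = model_aut p i\<^sub>b j\<^sub>c j\<^sub>a e m" if "m \<in> carrier ?M" for m
  proof -
    obtain i j k where m: "m = (int i, int j, int k)" "i < p" "j < p" "k < 4"
      by (rule carrier_modelE[OF \<open>m \<in> carrier ?M\<close>])
    have "m = (1, 0, 0) [^]\<^bsub>?M\<^esub> i \<otimes>\<^bsub>?M\<^esub> ((0, 1, 0) [^]\<^bsub>?M\<^esub> j \<otimes>\<^bsub>?M\<^esub> (0, 0, 1) [^]\<^bsub>?M\<^esub> k)"
      using m by (simp add: nat_pow_model_a nat_pow_model_b nat_pow_model_c mult_model alt_def)
    then have "f m = f (1, 0, 0) [^]\<^bsub>?M\<^esub> i \<otimes>\<^bsub>?M\<^esub>
        (f (0, 1, 0) [^]\<^bsub>?M\<^esub> j \<otimes>\<^bsub>?M\<^esub> f (0, 0, 1) [^]\<^bsub>?M\<^esub> k)"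
      using gens by (simp add: f_pow)
    then show ?thesis
      unfolding fg zero1 \<open>i\<^sub>c = 0\<close> \<open>j\<^sub>b = 0\<close> nat_pow_model_a[OF \<open>odd k\<^sub>a\<close>] nat_pow_model_b nat_pow_model_c m model_aut_def
      by (simp add: mult_model ka) (simp add: alt_def mod_simps)
  qed
  moreover have "i\<^sub>b \<in> {1..<int p}" "j\<^sub>c \<in> {1..<int p}" "j\<^sub>a \<in> {0..<int p}" "e \<in> {0..<2}"
    using bnd \<open>i\<^sub>b \<noteq> 0\<close> \<open>j\<^sub>c \<noteq> 0\<close> by (auto simp: carrier_model e_def)
  ultimately show ?thesis by (rule that[rotated -1])
qed

section \<open>The automorphism group\<close>

lemma scaling_hom:
  assumes p: "p > 0" and w: "\<And>y. y \<in> carrier K \<Longrightarrow> coprime (w y) (int p)"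
    and w_mult: "\<And>y y'. \<lbrakk>y \<in> carrier K; y' \<in> carrier K\<rbrakk> \<Longrightarrow> w (y \<otimes>\<^bsub>K\<^esub> y') = w y * w y' mod int p"
  shows "(\<lambda>y. \<lambda>n\<in>carrier (integer_mod_group p). w y * n mod int p) \<in> hom K (AutoGroup (integer_mod_group p))"
    (is "?\<phi> \<in> _")
proof (rule homI)
  have carr: "carrier (integer_mod_group p) = {0..<int p}"
    using p by (simp add: carrier_integer_mod_group)
  show *: "?\<phi> y \<in> carrier (AutoGroup (integer_mod_group p))" if "y \<in> carrier K" for y
  proof (rule restrict_in_AutoGroup)
    show "(\<lambda>n. w y * n mod int p) \<in> iso (integer_mod_group p) (integer_mod_group p)"
      using bij_betw_mult_mod[OF w[OF that]] p
      by (auto simp: iso_def hom_def carr mod_simps distrib_left)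
  qed simp
  fix y y' assume y: "y \<in> carrier K" "y' \<in> carrier K"
  have "?\<phi> (y \<otimes>\<^bsub>K\<^esub> y') = compose (carrier (integer_mod_group p)) (?\<phi> y) (?\<phi> y')"
    using p by (auto simp: compose_def carr w_mult[OF y] restrict_def fun_eq_iff mod_simps mult.assoc)
  then show "?\<phi> (y \<otimes>\<^bsub>K\<^esub> y') = ?\<phi> y \<otimes>\<^bsub>AutoGroup (integer_mod_group p)\<^esub> ?\<phi> y'"
    using y by (simp add: mult_AutoGroup *)
qed

theorem mainTheorem6:
  fixes p :: nat
  assumes "prime p" and "p \<noteq> 2" and "p \<noteq> 3"
  defines "G \<equiv> presented_group (G_relations p)"
    and "N \<equiv> integer_mod_group p"
    and "H \<equiv> (integer_mod_group (p - 1) \<times>\<times> integer_mod_group (p - 1)) \<times>\<times> integer_mod_group 2"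
  shows "\<exists>\<phi> \<in> hom H (AutoGroup N). AutoGroup G \<cong> semidirect_product N H \<phi>"
proof -
  have p1: "p > 1" using \<open>prime p\<close> by (rule prime_gt_1_nat)
  have group_M: "group (model p)" using p1 by (intro group_model) simp
  have "group G" unfolding G_def by (rule group_presented_group)
  have "group N" unfolding N_def by simp
  have "group H" unfolding H_def by (intro DirProd_group) simp_all
  let ?U = "integer_mod_group (p - 1)" and ?A = "AutoGroup (model p)"
  obtain w where w_bij: "bij_betw w (carrier ?U) {1..<int p}"
    and w_mult: "\<And>x y. \<lbrakk>x \<in> carrier ?U; y \<in> carrier ?U\<rbrakk> \<Longrightarrow> w (x \<otimes>\<^bsub>?U\<^esub> y) = w x * w y mod int p"
    using ex_discrete_exponential[OF \<open>prime p\<close>] by metis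
  have w_coprime: "coprime (w x) (int p)" if "x \<in> carrier ?U" for x
  proof -
    have "w x \<in> {1..<int p}" using w_bij that by (rule bij_betwE[rule_format])
    then have "\<not> int p dvd w x" by (auto dest: zdvd_imp_le)
    then show ?thesis
      using \<open>prime p\<close> by (simp add: coprime_commute prime_imp_coprime)
  qed
  have carr_H: "carrier H = (carrier ?U \<times> carrier ?U) \<times> {0..<2}"
    by (simp add: H_def carrier_integer_mod_group)
  have carr_N: "carrier N = {0..<int p}"
    using p1 by (simp add: N_def carrier_integer_mod_group)

  define \<phi> where "\<phi> h = (\<lambda>n\<in>carrier N. w (snd (fst h)) * n mod int p)" for h :: "(int \<times> int) \<times> int"
  have \<phi>: "\<phi> \<in> hom H (AutoGroup N)"
    unfolding \<phi>_def N_def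
  proof (rule scaling_hom)
    show "coprime (w (snd (fst h))) (int p)" if "h \<in> carrier H" for h
      using that w_coprime by (auto simp: carr_H)
    show "w (snd (fst (h \<otimes>\<^bsub>H\<^esub> h'))) = w (snd (fst h)) * w (snd (fst h')) mod int p"
      if "h \<in> carrier H" "h' \<in> carrier H" for h h'
      using that w_mult[of "snd (fst h)" "snd (fst h')"] by (cases h; cases h') (auto simp: carr_H, simp add: H_def)
  qed (use p1 in simp)
  let ?S = "semidirect_product N H \<phi>"
  have "group ?S" using \<open>group N\<close> \<open>group H\<close> \<phi> by (rule group_semidirect_product)

  \<comment> \<open>With \<open>n\<close> the exponent of \<open>c\<close> in the image of \<open>a\<close>, the action \<open>\<phi>\<close> is by the exponent
    of \<open>c\<close> in the image of \<open>c\<close>.\<close>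
  define F where "F = (\<lambda>(n, (x, y), t). restrict (model_aut p (w x) (w y) n t) (carrier (model p)))"
  have F: "F z \<in> carrier ?A" if "z \<in> carrier ?S" for z
    using that p1
    by (auto simp: F_def semidirect_product_def carr_H w_coprime
        intro!: restrict_in_AutoGroup[OF group_M] model_aut_iso)
  have "F \<in> hom ?S ?A"
  proof (rule homI)
    fix z z' assume z: "z \<in> carrier ?S" "z' \<in> carrier ?S"
    obtain n x y t n' x' y' t' where zz: "z = (n, (x, y), t)" "z' = (n', (x', y'), t')"
      by (metis prod.collapse)
    have in_carr: "n \<in> carrier N" "n' \<in> carrier N" "x \<in> carrier ?U" "x' \<in> carrier ?U"
        "y \<in> carrier ?U" "y' \<in> carrier ?U"
      using z by (auto simp: zz semidirect_product_def carr_H)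
    have mult: "z \<otimes>\<^bsub>?S\<^esub> z' =
        ((n + w y * n' mod int p) mod int p, (x \<otimes>\<^bsub>?U\<^esub> x', y \<otimes>\<^bsub>?U\<^esub> y'), (t + t') mod 2)"
      using in_carr by (simp add: zz semidirect_product_def \<phi>_def H_def N_def)
    show "F (z \<otimes>\<^bsub>?S\<^esub> z') = F z \<otimes>\<^bsub>?A\<^esub> F z'"
    proof (rule AutoGroup_eqI)
      show "F (z \<otimes>\<^bsub>?S\<^esub> z') \<in> carrier ?A"
        using F z group.is_monoid[OF \<open>group ?S\<close>] by (simp add: monoid.m_closed)
      show "F z \<otimes>\<^bsub>?A\<^esub> F z' \<in> carrier ?A"
        using F z group.is_monoid[OF group.AutoGroup[OF group_M]] by (simp add: monoid.m_closed)
      fix m assume m: "m \<in> carrier (model p)"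
      have "F z' m \<in> carrier (model p)" using F[OF z(2)] m by (rule AutoGroup_closed)
      then show "F (z \<otimes>\<^bsub>?S\<^esub> z') m = (F z \<otimes>\<^bsub>?A\<^esub> F z') m"
        unfolding mult_AutoGroup[OF F[OF z(1)] F[OF z(2)]] mult
        using m w_mult in_carr by (simp add: compose_def F_def zz model_aut_comp)
    qed
  qed (rule F)
  moreover have "inj_on F (carrier ?S)"
  proof (rule inj_onI)
    fix z z' assume z: "z \<in> carrier ?S" "z' \<in> carrier ?S" and eq: "F z = F z'"
    obtain n x y t n' x' y' t' where zz: "z = (n, (x, y), t)" "z' = (n', (x', y'), t')"
      by (metis prod.collapse)
    have in_carr: "n \<in> {0..<int p}" "n' \<in> {0..<int p}" "x \<in> carrier ?U" "x' \<in> carrier ?U"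
        "y \<in> carrier ?U" "y' \<in> carrier ?U" "t \<in> {0..<2}" "t' \<in> {0..<2}"
      using z by (auto simp: zz semidirect_product_def carr_H carr_N)
    have w_mod: "w x mod int p = w x" if "x \<in> carrier ?U" for x
    proof -
      have "w x \<in> {1..<int p}" using w_bij that by (rule bij_betwE[rule_format])
      then show ?thesis by simp
    qed
    have ev: "model_aut p (w x) (w y) n t m = model_aut p (w x') (w y') n' t' m"
      if "m \<in> carrier (model p)" for m
      using fun_cong[OF eq, of m] that by (simp add: F_def zz)
    have "w x = w x'" "w y = w y'" "n = n'" "alt t 1 mod 4 = alt t' 1 mod 4"
      using ev[of "(1, 0, 0)"] ev[of "(0, 1, 0)"] ev[of "(0, 0, 1)"] in_carr p1 in_carr(3-6)[THEN w_mod]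
      by (simp_all add: carrier_model model_aut_def)
    moreover have "t = t'"
    proof -
      have "t = 0 \<or> t = 1" "t' = 0 \<or> t' = 1" using in_carr by auto
      then show ?thesis using \<open>alt t 1 mod 4 = alt t' 1 mod 4\<close> by (auto simp: alt_def)
    qed
    ultimately show "z = z'"
      using in_carr w_bij by (auto simp: zz bij_betw_def dest: inj_onD)
  qed
  moreover have "carrier ?A \<subseteq> F ` carrier ?S"
  proof
    fix f assume f: "f \<in> carrier ?A"
    then have "f \<in> hom (model p) (model p)" "inj_on f (carrier (model p))"
      by (auto simp: carrier_AutoGroup bij_betw_def)
    then obtain u v s e where uv: "u \<in> {1..<int p}" "v \<in> {1..<int p}"
      and se: "s \<in> {0..<int p}" "e \<in> {0..<2}"
      and f_eq: "\<And>m. m \<in> carrier (model p) \<Longrightarrow> f m = model_aut p u v s e m"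
      using model_hom_is_model_aut[OF \<open>prime p\<close> \<open>p \<noteq> 2\<close>] by metis
    then obtain x y where xy: "x \<in> carrier ?U" "y \<in> carrier ?U" "u = w x" "v = w y"
      using bij_betw_imp_surj_on[OF w_bij] by (metis imageE)
    have z: "(s, (x, y), e) \<in> carrier ?S"
      using xy se by (simp add: semidirect_product_def carr_H carr_N)
    have "f = F (s, (x, y), e)"
      using f F[OF z] by (rule AutoGroup_eqI) (simp add: f_eq xy F_def)
    with z show "f \<in> F ` carrier ?S" by blast
  qed
  ultimately have "F \<in> iso ?S ?A"
    using F by (auto simp: iso_iff)
  then have "?A \<cong> ?S"
    using group.iso_sym[OF \<open>group ?S\<close>] by (auto dest: is_isoI)
  moreover have "AutoGroup G \<cong> ?A"
  proof (rule AutoGroup_cong[OF \<open>group G\<close> group_M])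
    show "G \<cong> model p"
      unfolding G_def using presented_group_iso_model[OF p1] group_M by (rule group.iso_sym[rotated])
  qed
  ultimately have "AutoGroup G \<cong> ?S" using iso_trans by blast
  with \<phi> show ?thesis by blast
qed

end
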